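(* Let $d \ge 2$ and $r \ge 2$ be integers. For every $\varepsilon > 0$ there exists a nonlinear map $g \in \mathcal{E}^r_d$ (depending on $\varepsilon$) and there exists $f \in \mathcal{E}^r_d$ (depending on $\varepsilon$ and $g$) such that $$\|f - g\|_{C^{r,1}} \le \varepsilon \quad\text{and}\quad \mathscr{L}(f) = \mathscr{L}(g),$$ but the marking conjugacy $\varphi$ between $f$ and $g$ is not $C^1$. Moreover, $g$ can be chosen to be arbitrarily close (depending on $\varepsilon$) to the linear map $L_d \colon x \mapsto d\cdot x \bmod 1$.
   Context: $\mathbb{S}^1 = \mathbb{R}/\mathbb{Z}$. A map is $C^{r,1}$-smooth if it has $r$ derivatives and the $r$-th derivative is Lipschitz. $\mathcal{E}^r_d$ is the class of $C^{r,1}$-smooth circle endomorphisms $f \colon \mathbb{S}^1 \to \mathbb{S}^1$ of degree $d$ with $f(0)=0$ and $f'(x) > 1$ for all $x \in \mathbb{S}^1$. For a real-valued $C^{r,1}$ function $u$ on $\mathbb{S}^1$, $\|u\|_{C^{r,1}}$ is the maximum of $\sup_{x}|u^{(j)}(x)|$, $0 \le j \le r$, and of the optimal Lipschitz constant of $u^{(r)}$. The difference of two degree $d$ maps fixing $0$ is regarded as a real-valued function on $\mathbb{S}^1$ via the lifts to $\mathbb{R}$ that fix $0$. For $f \in \mathcal{E}^r_d$, $\mathbb{P}^f_n$ is the set of all periodic points of $f$ of (possibly not exact) period $n$, i.e. $f^n(p)=p$; the log-multiplier of $p\in\mathbb{P}^f_n$ is $\lambda^f(p) = \log (f^n)'(p)$;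 $\mathscr{L}_n(f) = \{\lambda^f(p) : p \in \mathbb{P}^f_n\}$; and the (unmarked) length spectrum is the set $\mathscr{L}(f) = \bigcup_{n \in \mathbb{N}} \mathscr{L}_n(f)$. Any two maps $f, g \in \mathcal{E}^r_d$ are topologically conjugate by an orientation-preserving homeomorphism $\varphi\colon \mathbb{S}^1 \to \mathbb{S}^1$ respecting the symbolic dynamics (with $\varphi(0)=0$): $g = \varphi \circ f \circ \varphi^{-1}$; this $\varphi$ is called the marking conjugacy. *)

theory Defs
  imports "HOL-Analysis.Analysis"
begin

section \<open>The circle \<open>\<real>/\<int>\<close>\<close>

quotient_type circle = real / "\<lambda>x y :: real. x - y \<in> \<int>"
  morphisms rep_circle circ
proof (rule equivpI)
  show "reflp (\<lambda>x y :: real. x - y \<in> \<int>)"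
    by (simp add: reflp_def)
  show "symp (\<lambda>x y :: real. x - y \<in> \<int>)"
    unfolding symp_def by (metis Ints_minus minus_diff_eq)
  show "transp (\<lambda>x y :: real. x - y \<in> \<int>)"
    unfolding transp_def
    by (metis Ints_add diff_add_cancel add_diff_eq)
qed

lemma circ_eq_iff: "circ x = circ y \<longleftrightarrow> x - y \<in> \<int>"
  by (rule circle.abs_eq_iff)

lemma circ_rep_circle [simp]: "circ (rep_circle p) = p"
  by (rule Quotient_abs_rep[OF Quotient_circle])

instantiation circle :: topological_space
begin

definition open_circle :: "circle set \<Rightarrow> bool" where
  "open_circle U \<longleftrightarrow> open (circ -` U)"

instance
  by standard (auto simp: open_circle_def vimage_Union)

end

lemma continuous_circ: "continuous_on UNIV circ"
  by (simp add: continuous_on_open_vimage open_circle_def)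

section \<open>Lifts\<close>

definition is_lift :: "(real \<Rightarrow> real) \<Rightarrow> (circle \<Rightarrow> circle) \<Rightarrow> bool" where
  "is_lift F f \<longleftrightarrow> continuous_on UNIV F \<and> (\<forall>x. circ (F x) = f (circ x))"

lemma is_lift_unique:
  assumes "is_lift F f" "is_lift G f"
  shows "\<exists>k :: int. \<forall>x. F x = G x + of_int k"
proof -
  have "(\<lambda>x. F x - G x) constant_on UNIV"
  proof (rule continuous_discrete_range_constant)
    show "connected (UNIV :: real set)" by simp
    show "continuous_on UNIV (\<lambda>x. F x - G x)"
      using assms unfolding is_lift_def by (intro continuous_intros) auto
    fix x :: real
    show "\<exists>e>0. \<forall>y. y \<in> UNIV \<and> F y - G y \<noteq> F x - G x \<longrightarrow>
        e \<le> norm (F y - G y - (F x - G x))"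
    proof (intro exI[of _ 1] conjI allI impI)
      fix y assume ne: "y \<in> UNIV \<and> F y - G y \<noteq> F x - G x"
      have "F y - G y \<in> \<int>" "F x - G x \<in> \<int>"
        using assms unfolding is_lift_def circ_eq_iff[symmetric] by auto
      then have "F y - G y - (F x - G x) \<in> \<int>" by (rule Ints_diff)
      then show "1 \<le> norm (F y - G y - (F x - G x))"
        using ne Ints_nonzero_abs_ge1[of "F y - G y - (F x - G x)"] by auto
    qed simp
  qed
  then obtain c where c: "\<And>x. F x - G x = c" unfolding constant_on_def by auto
  have "F 0 - G 0 \<in> \<int>"
    using assms unfolding is_lift_def circ_eq_iff[symmetric] by auto
  then obtain k where "c = of_int k" using c by (metis Ints_cases)
  then show ?thesis using c by (metis add.commute diff_add_cancel)
qed

text \<open>For continuous \<open>f\<close> with \<open>f(0) = 0\<close>, the unique lift that fixes \<open>0\<close>.\<close>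

definition lift0 :: "(circle \<Rightarrow> circle) \<Rightarrow> real \<Rightarrow> real" where
  "lift0 f = (THE F. is_lift F f \<and> F 0 = 0)"

lemma lift0_eq:
  assumes "is_lift F f" "F 0 = 0"
  shows "lift0 f = F"
  unfolding lift0_def
proof (rule the_equality)
  fix G assume G: "is_lift G f \<and> G 0 = 0"
  then obtain k :: int where k: "\<forall>x. G x = F x + of_int k"
    using is_lift_unique assms(1) by blast
  then have "of_int k = (0::real)" using G assms(2) by (metis add_0)
  then show "G = F" using k by auto
qed (use assms in simp)

definition has_degree :: "(circle \<Rightarrow> circle) \<Rightarrow> int \<Rightarrow> bool" where
  "has_degree f d \<longleftrightarrow> (\<exists>F. is_lift F f \<and> (\<forall>x. F (x + 1) = F x + of_int d))"

definition circle_deriv :: "(circle \<Rightarrow> circle) \<Rightarrow> circle \<Rightarrow> real" where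
  "circle_deriv f p =
     (THE D. \<exists>F x. is_lift F f \<and> circ x = p \<and> (F has_real_derivative D) (at x))"

lemma has_derivative_lift_unique:
  assumes "is_lift F f" "(F has_real_derivative D) (at x)"
    and "is_lift G f" "(G has_real_derivative E) (at y)"
    and "circ x = circ y"
  shows "D = E"
proof -
  obtain m :: int where m: "x - y = of_int m"
    using assms(5) by (auto simp: circ_eq_iff elim: Ints_cases)
  have per: "circ (t + of_int m) = circ t" for t
    by (simp add: circ_eq_iff)
  have "is_lift (\<lambda>t. F (t + of_int m)) f"
    using assms(1) unfolding is_lift_def per
    by (auto intro!: continuous_on_compose2[of UNIV F] continuous_intros simp: per)
  then obtain k :: int where k: "\<forall>t. F (t + of_int m) = G t + of_int k"
    using is_lift_unique assms(3) by blast
  have "(F has_real_derivative D) (at (y + of_int m))"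
    using assms(2) m by (simp add: algebra_simps)
  then have "((\<lambda>t. F (t + of_int m)) has_real_derivative D) (at y)"
    by (simp add: DERIV_shift)
  moreover have "((\<lambda>t. F (t + of_int m)) has_real_derivative E) (at y)"
    using assms(4) k by (auto intro!: derivative_eq_intros)
  ultimately show ?thesis by (rule DERIV_unique)
qed

lemma circle_deriv_eq:
  assumes "is_lift F f" "(F has_real_derivative D) (at x)"
  shows "circle_deriv f (circ x) = D"
  unfolding circle_deriv_def
  using assms has_derivative_lift_unique by (intro the_equality) blast+

section \<open>Smoothness classes and the \<open>C\<^bsup>r,1\<^esup>\<close> norm\<close>

definition Cr1_smooth :: "nat \<Rightarrow> (real \<Rightarrow> real) \<Rightarrow> bool" where
  "Cr1_smooth r u \<longleftrightarrow>
     (\<forall>j<r. \<forall>x. (deriv ^^ j) u field_differentiable (at x)) \<and>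
     (\<exists>L. L-lipschitz_on UNIV ((deriv ^^ r) u))"

definition circle_Cr1_smooth :: "nat \<Rightarrow> (circle \<Rightarrow> circle) \<Rightarrow> bool" where
  "circle_Cr1_smooth r f \<longleftrightarrow> (\<exists>F. is_lift F f \<and> Cr1_smooth r F)"

definition circle_C1 :: "(circle \<Rightarrow> circle) \<Rightarrow> bool" where
  "circle_C1 f \<longleftrightarrow> (\<exists>F. is_lift F f \<and> F C1_differentiable_on UNIV)"

text \<open>
  A function \<open>u\<close> on the circle is differentiated through its 1-periodic pullback to the line.
  The optimal Lipschitz constant of a 1-periodic function on \<open>\<real>\<close> equals the one with respect
  to the quotient metric on \<open>\<real>/\<int>\<close>. The value is meaningful only when the pullback is
  \<open>Cr1_smooth r\<close>, since suprema and infima are taken in \<open>real\<close>.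
\<close>

definition Cr1_norm :: "nat \<Rightarrow> (circle \<Rightarrow> real) \<Rightarrow> real" where
  "Cr1_norm r u =
     Max ((\<lambda>j. SUP x. \<bar>(deriv ^^ j) (u \<circ> circ) x\<bar>) ` {..r} \<union>
          {Inf {L. L-lipschitz_on UNIV ((deriv ^^ r) (u \<circ> circ))}})"

text \<open>
  For maps of equal degree fixing \<open>0\<close> the difference of lifts is 1-periodic, so the choice of
  representative is immaterial (see \<open>lift_diff_circ\<close> below).
\<close>

definition lift_diff :: "(circle \<Rightarrow> circle) \<Rightarrow> (circle \<Rightarrow> circle) \<Rightarrow> circle \<Rightarrow> real" where
  "lift_diff f g p = lift0 f (rep_circle p) - lift0 g (rep_circle p)"

section \<open>Expanding circle maps\<close>

definition expanding_maps :: "nat \<Rightarrow> nat \<Rightarrow> (circle \<Rightarrow> circle) set" where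
  "expanding_maps r d =
     {f. circle_Cr1_smooth r f \<and> has_degree f (int d) \<and> f (circ 0) = circ 0 \<and>
         (\<forall>p. circle_deriv f p > 1)}"

lift_definition linear_circle_map :: "nat \<Rightarrow> circle \<Rightarrow> circle" is
  "\<lambda>d x. of_nat d * x"
  by (metis Ints_mult Ints_of_nat right_diff_distrib)

definition periodic_points :: "(circle \<Rightarrow> circle) \<Rightarrow> nat \<Rightarrow> circle set" where
  "periodic_points f n = {p. (f ^^ n) p = p}"

definition log_multiplier :: "(circle \<Rightarrow> circle) \<Rightarrow> nat \<Rightarrow> circle \<Rightarrow> real" where
  "log_multiplier f n p = ln (circle_deriv (f ^^ n) p)"

definition length_spectrum_of_period :: "(circle \<Rightarrow> circle) \<Rightarrow> nat \<Rightarrow> real set" where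
  "length_spectrum_of_period f n = log_multiplier f n ` periodic_points f n"

definition length_spectrum :: "(circle \<Rightarrow> circle) \<Rightarrow> real set" where
  "length_spectrum f = (\<Union>n\<in>{1..}. length_spectrum_of_period f n)"

definition orientation_preserving :: "(circle \<Rightarrow> circle) \<Rightarrow> bool" where
  "orientation_preserving \<phi> \<longleftrightarrow> (\<exists>F. is_lift F \<phi> \<and> strict_mono F)"

text \<open>
  For maps in \<open>expanding_maps r d\<close> these conditions determine \<open>\<phi>\<close> uniquely. They also force
  \<open>\<phi>\<close> to respect the symbolic dynamics: being increasing, fixing \<open>0\<close> and intertwining \<open>f\<close>
  and \<open>g\<close>, it sends the \<open>i\<close>-th preimage of \<open>0\<close> under \<open>f\<close> to the \<open>i\<close>-th one under \<open>g\<close>, hence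
  the corresponding Markov partitions to one another.
\<close>

definition marking_conjugacy ::
  "(circle \<Rightarrow> circle) \<Rightarrow> (circle \<Rightarrow> circle) \<Rightarrow> (circle \<Rightarrow> circle) \<Rightarrow> bool" where
  "marking_conjugacy f g \<phi> \<longleftrightarrow>
     (\<exists>\<psi>. homeomorphism UNIV UNIV \<phi> \<psi> \<and> g = \<phi> \<circ> f \<circ> \<psi>) \<and>
     orientation_preserving \<phi> \<and> \<phi> (circ 0) = circ 0"

section \<open>Well-definedness\<close>

lemma expanding_maps_lift0:
  assumes "f \<in> expanding_maps r d"
  shows "is_lift (lift0 f) f" "lift0 f 0 = 0" "lift0 f (x + 1) = lift0 f x + of_nat d"
proof -
  obtain F where F: "is_lift F f" "\<forall>x. F (x + 1) = F x + of_int (int d)"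
    using assms unfolding expanding_maps_def has_degree_def by auto
  have "circ (F 0) = circ 0"
    using F(1) assms unfolding is_lift_def expanding_maps_def by auto
  then have "F 0 \<in> \<int>" by (simp add: circ_eq_iff)
  then have *: "circ (F x - F 0) = circ (F x)" for x
    by (simp add: circ_eq_iff)
  have "is_lift (\<lambda>x. F x - F 0) f"
    using F(1) * unfolding is_lift_def by (auto intro!: continuous_intros)
  moreover from this have eq: "lift0 f = (\<lambda>x. F x - F 0)"
    by (rule lift0_eq) simp
  ultimately show "is_lift (lift0 f) f" "lift0 f 0 = 0"
      "lift0 f (x + 1) = lift0 f x + of_nat d"
    using F(2) by simp_all
qed

lemma lift_diff_circ:
  assumes "f \<in> expanding_maps r d" "g \<in> expanding_maps r d"
  shows "lift_diff f g (circ x) = lift0 f x - lift0 g x"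
proof -
  let ?u = "\<lambda>x. lift0 f x - lift0 g x"
  have 1: "?u (x + 1) = ?u x" for x
    using expanding_maps_lift0(3)[OF assms(1)] expanding_maps_lift0(3)[OF assms(2)] by simp
  have nat: "?u (x + of_nat n) = ?u x" for x n
  proof (induction n)
    case (Suc n)
    then show ?case using 1[of "x + of_nat n"] by (simp add: algebra_simps)
  qed simp
  have int: "?u (x + of_int k) = ?u x" for x k
  proof (cases k rule: int_cases2)
    case (nonneg n)
    then show ?thesis using nat[of x n] by simp
  next
    case (nonpos n)
    then show ?thesis using nat[of "x - of_nat n" n] by simp
  qed
  have "rep_circle (circ x) - x \<in> \<int>"
    by (simp add: circ_eq_iff[symmetric])
  then obtain k where "rep_circle (circ x) = x + of_int k"
    by (metis Ints_cases add.commute diff_add_cancel)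
  then show ?thesis using int[of x k] by (simp add: lift_diff_def)
qed

lemma is_lift_linear: "is_lift (\<lambda>x. of_nat d * x) (linear_circle_map d)"
  unfolding is_lift_def by (auto simp: linear_circle_map.abs_eq intro!: continuous_intros)

lemma linear_circle_map_expanding:
  assumes "d \<ge> 2"
  shows "linear_circle_map d \<in> expanding_maps r d"
proof -
  let ?F = "\<lambda>x :: real. of_nat d * x"
  have d1: "deriv ?F = (\<lambda>_. of_nat d)"
    by (rule ext, rule DERIV_imp_deriv) (auto intro!: derivative_eq_intros)
  have d2: "(deriv ^^ j) (\<lambda>_. c) = (\<lambda>_. if j = 0 then c else 0)" for c :: real and j
    by (induction j) auto
  have ds: "(deriv ^^ j) ?F = (if j = 0 then ?F else (\<lambda>_. if j = 1 then of_nat d else 0))" for j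
    by (cases j) (auto simp: funpow_Suc_right d1 d2 simp del: funpow.simps)
  have "Cr1_smooth r ?F"
    unfolding Cr1_smooth_def
  proof
    show "\<forall>j<r. \<forall>x. (deriv ^^ j) ?F field_differentiable at x"
      by (auto simp: ds intro!: derivative_intros)
    show "\<exists>L. L-lipschitz_on UNIV ((deriv ^^ r) ?F)"
      by (intro exI[of _ "of_nat d"] lipschitz_onI)
         (auto simp: ds dist_real_def right_diff_distrib[symmetric] abs_mult)
  qed
  then have "circle_Cr1_smooth r (linear_circle_map d)"
    unfolding circle_Cr1_smooth_def using is_lift_linear by blast
  moreover have "has_degree (linear_circle_map d) (int d)"
    unfolding has_degree_def
    by (intro exI[of _ ?F] conjI is_lift_linear) (simp add: algebra_simps)
  moreover have "linear_circle_map d (circ 0) = circ 0"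
    by (simp add: linear_circle_map.abs_eq)
  moreover have "circle_deriv (linear_circle_map d) p > 1" for p
  proof -
    have "(?F has_real_derivative of_nat d) (at (rep_circle p))"
      by (auto intro!: derivative_eq_intros)
    from circle_deriv_eq[OF is_lift_linear this] show ?thesis using assms by simp
  qed
  ultimately show ?thesis by (simp add: expanding_maps_def)
qed

end

theory Submission
  imports Defs
begin

text \<open>
  Conjugating \<open>g\<close> by the reflection \<open>x \<mapsto> - x\<close> gives a map \<open>f\<close> with the same unmarked length
  spectrum, and \<open>f\<close> is close to \<open>g\<close> when both are close to the linear map. The marking
  conjugacy, however, preserves orientation. Take \<open>g = d x + h\<close> and \<open>f = d x - h\<close> with \<open>h\<close> small,
  even, and vanishing on the multiples of \<open>1 / N\<close>, \<open>N = d\<^sup>3 - 1\<close>. Both maps have the orbit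
  \<open>1 / N, d / N, d\<^sup>2 / N\<close> of period 3, the marking conjugacy fixes it pointwise, and \<open>h\<close> is such
  that its multipliers for \<open>f\<close> and \<open>g\<close> differ. A \<open>C\<^sup>1\<close> conjugacy of expanding maps has
  nowhere vanishing derivative, so it would preserve them.
\<close>

section \<open>Circle maps from lifts\<close>

definition circle_map :: "(real \<Rightarrow> real) \<Rightarrow> circle \<Rightarrow> circle" where
  "circle_map F p = circ (F (rep_circle p))"

lemma shift_of_int:
  fixes F :: "real \<Rightarrow> real"
  assumes "\<And>x. F (x + 1) = F x + c"
  shows "F (x + of_int k) = F x + of_int k * c"
proof -
  have nat: "F (x + of_nat n) = F x + of_nat n * c" for x n
  proof (induction n)
    case (Suc n)
    then show ?case using assms[of "x + of_nat n"] by (simp add: algebra_simps)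
  qed simp
  show ?thesis
  proof (cases k rule: int_cases2)
    case (nonneg n)
    then show ?thesis using nat[of x n] by simp
  next
    case (nonpos n)
    then show ?thesis using nat[of "x - of_nat n" n] by simp
  qed
qed

lemma is_lift_circle_map:
  assumes "continuous_on UNIV F" "\<And>x. F (x + 1) = F x + of_int m"
  shows "is_lift F (circle_map F)"
  unfolding is_lift_def circle_map_def
proof (intro conjI allI)
  fix x
  have "rep_circle (circ x) - x \<in> \<int>"
    by (simp add: circ_eq_iff[symmetric])
  then obtain k where k: "rep_circle (circ x) = x + of_int k"
    by (metis Ints_cases add.commute diff_add_cancel)
  show "circ (F x) = circ (F (rep_circle (circ x)))"
    unfolding k using shift_of_int[of F "of_int m" x k] assms(2) by (simp add: circ_eq_iff)
qed fact

lemma circ_surj: "\<exists>x. p = circ x"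
  by (metis circ_rep_circle)

lemma is_lift_map_unique: "is_lift F f \<Longrightarrow> is_lift F g \<Longrightarrow> f = g"
  unfolding is_lift_def by (metis circ_surj ext)

lemma is_lift_compose: "is_lift F f \<Longrightarrow> is_lift G g \<Longrightarrow> is_lift (F \<circ> G) (f \<circ> g)"
  unfolding is_lift_def by (auto simp: o_def intro: continuous_on_compose2[of UNIV F UNIV G])

lemma is_lift_id: "is_lift id id"
  by (simp add: is_lift_def)

lemma is_lift_funpow: "is_lift F f \<Longrightarrow> is_lift (F ^^ n) (f ^^ n)"
  by (induction n) (simp_all add: is_lift_id is_lift_compose)

lemma is_lift_continuous:
  assumes "is_lift F f"
  shows "continuous_on UNIV f"
proof -
  have "open (f -` U)" if "open U" for U
  proof -
    have "circ -` (f -` U) = F -` (circ -` U)"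
      using assms by (auto simp: is_lift_def)
    moreover have "open (F -` (circ -` U))"
      using that assms by (auto simp: is_lift_def open_circle_def intro: open_vimage)
    ultimately show ?thesis by (simp add: open_circle_def)
  qed
  then show ?thesis by (simp add: continuous_on_open_vimage)
qed

section \<open>Conjugating expanding maps to the linear one\<close>

lemma continuous_on_funpow:
  fixes F :: "real \<Rightarrow> real"
  assumes "continuous_on UNIV F"
  shows "continuous_on UNIV (F ^^ n)"
proof (induction n)
  case 0
  show ?case by (simp add: id_def)
next
  case (Suc n)
  then show ?case using continuous_on_compose2[OF assms Suc] by (simp add: o_def)
qed

lemma expanding_funpow:
  fixes G :: "real \<Rightarrow> real"
  assumes "\<And>x y. x \<le> y \<Longrightarrow> lam * (y - x) \<le> G y - G x" "lam > 1" "x \<le> y"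
  shows "lam ^ n * (y - x) \<le> (G ^^ n) y - (G ^^ n) x"
proof (induction n)
  case (Suc n)
  have "0 \<le> lam ^ n * (y - x)" using assms by simp
  then have le: "(G ^^ n) x \<le> (G ^^ n) y" using Suc by linarith
  have "lam ^ Suc n * (y - x) \<le> lam * ((G ^^ n) y - (G ^^ n) x)"
    using mult_left_mono[OF Suc, of lam] assms(2) by (simp add: mult.assoc)
  also have "\<dots> \<le> (G ^^ Suc n) y - (G ^^ Suc n) x"
    using assms(1)[OF le] by simp
  finally show ?case .
qed simp

lemma expanding_funpow_exceeds:
  fixes G :: "real \<Rightarrow> real"
  assumes "\<And>x y. x \<le> y \<Longrightarrow> lam * (y - x) \<le> G y - G x" "lam > 1" "x < y"
  obtains n where "(G ^^ n) y - (G ^^ n) x > 1"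
proof -
  obtain n where "1 / (y - x) < lam ^ n"
    using real_arch_pow[OF assms(2)] by blast
  then have "1 < lam ^ n * (y - x)" using assms(3) by (simp add: field_simps)
  then show thesis
    using expanding_funpow[of lam G x y n] assms by (intro that[of n]) fastforce
qed

lemma expanding_linearization:
  fixes G :: "real \<Rightarrow> real"
  assumes cont: "continuous_on UNIV G"
    and deg: "\<And>x. G (x + 1) = G x + real d" and "d > 1" and "G 0 = 0"
    and bd: "\<And>x. \<bar>G x - real d * x\<bar> \<le> C"
    and exp: "\<And>x y. x \<le> y \<Longrightarrow> lam * (y - x) \<le> G y - G x" "lam > 1"
  obtains H where "continuous_on UNIV H" "strict_mono H" "H 0 = 0"
    "\<And>x. H (x + 1) = H x + 1" "\<And>x. H (G x) = real d * H x"
proof -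
  define t where "t n x = (G ((G ^^ n) x) - real d * (G ^^ n) x) / real d ^ Suc n" for n x
  define H where "H x = x + (\<Sum>n. t n x)" for x
  have tel: "x + (\<Sum>i<n. t i x) = (G ^^ n) x / real d ^ n" for x n
  proof (induction n)
    case (Suc n)
    have "x + (\<Sum>i<Suc n. t i x) = (G ^^ n) x / real d ^ n + t n x"
      using Suc by simp
    also have "\<dots> = (G ^^ Suc n) x / real d ^ Suc n"
      using \<open>d > 1\<close> by (simp add: t_def diff_divide_distrib)
    finally show ?case .
  qed simp
  have bdt: "norm (t n x) \<le> C * (1 / real d) ^ Suc n" for n x
  proof -
    have "norm (t n x) = \<bar>G ((G ^^ n) x) - real d * (G ^^ n) x\<bar> / real d ^ Suc n"
      by (simp add: t_def abs_divide del: power_Suc)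
    also have "\<dots> \<le> C / real d ^ Suc n"
      by (intro divide_right_mono bd) simp
    finally show ?thesis by (simp only: divide_inverse mult_1 power_inverse)
  qed
  have sm: "summable (\<lambda>n. C * (1 / real d) ^ Suc n)"
    using \<open>d > 1\<close> by (intro summable_mult) (simp add: summable_geometric)
  have ul: "uniform_limit UNIV (\<lambda>n x. \<Sum>i<n. t i x) (\<lambda>x. \<Sum>i. t i x) sequentially"
    by (rule Weierstrass_m_test[OF bdt sm])
  have contn: "continuous_on UNIV (G ^^ n)" for n
    by (rule continuous_on_funpow[OF cont])
  have contt: "continuous_on UNIV (t n)" for n
    unfolding t_def using \<open>d > 1\<close>
    by (intro continuous_intros contn continuous_on_compose2[OF cont contn]) auto
  have "continuous_on UNIV (\<lambda>x. \<Sum>i. t i x)"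
    by (rule uniform_limit_theorem[OF _ ul]) (auto intro!: always_eventually continuous_intros contt)
  then have contH: "continuous_on UNIV H"
    unfolding H_def by (intro continuous_intros)
  have lim: "(\<lambda>n. (G ^^ n) x / real d ^ n) \<longlonglongrightarrow> H x" for x
    using tendsto_add[OF tendsto_const[of x] tendsto_uniform_limitI[OF ul UNIV_I, of x]]
    by (simp add: H_def tel)
  have G0: "(G ^^ n) 0 = 0" for n
    using \<open>G 0 = 0\<close> by (induction n) auto
  have H0: "H 0 = 0"
    using lim[of 0] by (simp add: G0 LIMSEQ_const_iff)
  have degn: "(G ^^ n) (x + 1) = (G ^^ n) x + real d ^ n" for n x
  proof (induction n)
    case (Suc n)
    have "G ((G ^^ n) x + of_int (int d ^ n)) = G ((G ^^ n) x) + real d ^ n * real d"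
      using shift_of_int[of G "real d" "(G ^^ n) x" "int d ^ n"] deg by simp
    then show ?case using Suc by (simp add: mult.commute)
  qed simp
  have H1: "H (x + 1) = H x + 1" for x
  proof -
    have "(\<lambda>n. (G ^^ n) x / real d ^ n + 1) \<longlonglongrightarrow> H (x + 1)"
      using lim[of "x + 1"] \<open>d > 1\<close> by (simp add: degn add_divide_distrib)
    moreover have "(\<lambda>n. (G ^^ n) x / real d ^ n + 1) \<longlonglongrightarrow> H x + 1"
      by (intro tendsto_add lim tendsto_const)
    ultimately show ?thesis by (rule LIMSEQ_unique)
  qed
  have HG: "H (G x) = real d * H x" for x
  proof -
    have "(\<lambda>n. real d * ((G ^^ Suc n) x / real d ^ Suc n)) \<longlonglongrightarrow> real d * H x"
      by (intro tendsto_mult tendsto_const LIMSEQ_Suc lim)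
    moreover have "(\<lambda>n. real d * ((G ^^ Suc n) x / real d ^ Suc n)) = (\<lambda>n. (G ^^ n) (G x) / real d ^ n)"
      using \<open>d > 1\<close> by (simp add: funpow_swap1)
    ultimately show ?thesis using lim[of "G x"] by (metis LIMSEQ_unique)
  qed
  have HGn: "H ((G ^^ n) x) = real d ^ n * H x" for n x
    by (induction n) (simp_all add: HG)
  have mono: "H x \<le> H y" if "x \<le> y" for x y
  proof (rule LIMSEQ_le[OF lim lim], intro exI allI impI)
    fix n
    have "0 \<le> lam ^ n * (y - x)" using that exp(2) by simp
    also have "\<dots> \<le> (G ^^ n) y - (G ^^ n) x" by (rule expanding_funpow[OF exp that])
    finally show "(G ^^ n) x / real d ^ n \<le> (G ^^ n) y / real d ^ n"
      by (intro divide_right_mono) auto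
  qed
  have "strict_mono H"
  proof (rule strict_monoI)
    fix x y :: real
    assume "x < y"
    then obtain n where "(G ^^ n) y - (G ^^ n) x > 1"
      using expanding_funpow_exceeds[of lam G x y] exp by blast
    then have "H ((G ^^ n) x) + 1 \<le> H ((G ^^ n) y)"
      unfolding H1[symmetric] by (intro mono) simp
    then have "real d ^ n * H x < real d ^ n * H y" by (simp add: HGn)
    then show "H x < H y" using \<open>d > 1\<close> by simp
  qed
  then show thesis using that contH H0 H1 HG by blast
qed

lemma degree_one_inverse:
  fixes H :: "real \<Rightarrow> real"
  assumes cont: "continuous_on UNIV H" and mono: "strict_mono H"
    and deg: "\<And>x. H (x + 1) = H x + 1"
  obtains K where "continuous_on UNIV K" "strict_mono K" "\<And>x. K (x + 1) = K x + 1"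
    "\<And>x. K (H x) = x" "\<And>x. H (K x) = x"
proof -
  have "\<exists>x. H x = y" for y
  proof -
    obtain k where k: "\<bar>y - H 0\<bar> \<le> real k" using real_arch_simple by blast
    have "H (of_int (int k)) = H 0 + real k" "H (of_int (- int k)) = H 0 - real k"
      using shift_of_int[of H 1 0 "int k"] shift_of_int[of H 1 0 "- int k"] deg by simp_all
    then have "H (- real k) \<le> y" "y \<le> H (real k)" using k by auto
    then show ?thesis
      using IVT'[of H "- real k" y "real k"] continuous_on_subset[OF cont] by auto
  qed
  then obtain K where HK: "\<And>y. H (K y) = y" by metis
  have KH: "K (H x) = x" for x
    using HK strict_mono_eq[OF mono] by metis
  have "isCont K (H x)" for x
    using KH cont by (intro isCont_inverse_function[of 1 x K H]) (auto simp: continuous_on_eq_continuous_at)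
  then have "continuous_on UNIV K"
    by (metis HK continuous_at_imp_continuous_on)
  moreover have "strict_mono K"
    by (rule strict_monoI) (metis HK strict_mono_less[OF mono])
  moreover have "K (x + 1) = K x + 1" for x
    by (metis HK KH deg)
  ultimately show thesis using that KH HK by blast
qed

lemma marking_conjugacy_of_lifts:
  assumes "is_lift F f" "is_lift G g" and \<Phi>: "is_lift \<Phi> \<phi>" and \<Psi>: "is_lift \<Psi> \<psi>"
    and inv: "\<And>x. \<Psi> (\<Phi> x) = x" "\<And>x. \<Phi> (\<Psi> x) = x"
    and "strict_mono \<Phi>" "\<Phi> 0 = 0" and conj: "\<And>x. \<Phi> (F x) = G (\<Phi> x)"
  shows "marking_conjugacy f g \<phi>"
proof -
  have i: "\<psi> \<circ> \<phi> = id" "\<phi> \<circ> \<psi> = id"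
    using is_lift_map_unique[OF is_lift_compose[OF \<Psi> \<Phi>], of id]
      is_lift_map_unique[OF is_lift_compose[OF \<Phi> \<Psi>], of id] inv is_lift_id
    by (simp_all add: o_def id_def)
  have "\<Phi> \<circ> F \<circ> \<Psi> = G"
    by (simp add: fun_eq_iff conj inv)
  then have "g = \<phi> \<circ> f \<circ> \<psi>"
    using is_lift_map_unique[of G g] is_lift_compose[OF is_lift_compose[OF \<Phi> assms(1)] \<Psi>] assms(2)
    by metis
  moreover have "homeomorphism UNIV UNIV \<phi> \<psi>"
    using i \<Phi> \<Psi> by (intro homeomorphismI) (auto simp: is_lift_continuous fun_eq_iff)
  moreover have "\<phi> (circ 0) = circ 0"
    using \<Phi> \<open>\<Phi> 0 = 0\<close> unfolding is_lift_def by metis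
  ultimately show ?thesis
    unfolding marking_conjugacy_def orientation_preserving_def using \<Phi> assms by blast
qed

section \<open>\<open>C\<^sup>1\<close> conjugacies preserve multipliers\<close>

lemma conjugacy_chain_rule:
  fixes \<Phi> F G :: "real \<Rightarrow> real"
  assumes "\<And>x. (\<Phi> has_real_derivative D x) (at x)"
    and "\<And>x. (F has_real_derivative F' x) (at x)" "\<And>x. (G has_real_derivative G' x) (at x)"
    and "\<And>x. \<Phi> (F x) = G (\<Phi> x)"
  shows "D (F x) * F' x = G' (\<Phi> x) * D x"
proof (rule DERIV_unique)
  show "((\<lambda>x. \<Phi> (F x)) has_real_derivative D (F x) * F' x) (at x)"
    by (rule DERIV_chain2) (rule assms)+
  show "((\<lambda>x. \<Phi> (F x)) has_real_derivative G' (\<Phi> x) * D x) (at x)"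
    unfolding assms(4) by (rule DERIV_chain2) (rule assms)+
qed

lemma deriv_periodic:
  fixes \<Phi> :: "real \<Rightarrow> real"
  assumes "\<And>x. (\<Phi> has_real_derivative D x) (at x)" "\<And>x. \<Phi> (x + 1) = \<Phi> x + c"
  shows "D (x + 1) = D x"
proof (rule DERIV_unique)
  show "((\<lambda>x. \<Phi> (x + 1)) has_real_derivative D (x + 1)) (at x)"
    using assms(1)[of "x + 1"] by (simp add: DERIV_shift)
  show "((\<lambda>x. \<Phi> (x + 1)) has_real_derivative D x) (at x)"
    unfolding assms(2) using assms(1)[of x] by (auto intro!: derivative_eq_intros)
qed

text \<open>
  The set where \<open>D \<noteq> 0\<close> is open, nonempty and forward invariant under \<open>F\<close>, and \<open>F\<close>
  stretches every interval until it covers the circle.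
\<close>

lemma C1_conjugacy_deriv_nonzero:
  fixes \<Phi> F G :: "real \<Rightarrow> real"
  assumes D: "\<And>x. (\<Phi> has_real_derivative D x) (at x)" and contD: "continuous_on UNIV D"
    and deg: "\<And>x. \<Phi> (x + 1) = \<Phi> x + 1"
    and F: "\<And>x. (F has_real_derivative F' x) (at x)"
    and G: "\<And>x. (G has_real_derivative G' x) (at x)" "\<And>x. G' x \<noteq> 0"
    and conj: "\<And>x. \<Phi> (F x) = G (\<Phi> x)"
    and exp: "\<And>x y. x \<le> y \<Longrightarrow> lam * (y - x) \<le> F y - F x" "lam > 1"
  shows "D y \<noteq> 0"
proof -
  have "\<exists>x. D x \<noteq> 0"
  proof (rule ccontr)
    assume "\<not> ?thesis"
    then have "(\<Phi> has_real_derivative 0) (at x)" for x using D[of x] by simp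
    then have "\<Phi> 1 = \<Phi> 0" by (intro DERIV_isconst_all) blast
    then show False using deg[of 0] by simp
  qed
  then obtain x where "D x \<noteq> 0" ..
  moreover have "open {x. D x \<noteq> 0}"
    by (intro open_Collect_neq contD continuous_on_const)
  ultimately obtain e where e: "e > 0" "cball x e \<subseteq> {x. D x \<noteq> 0}"
    using open_contains_cball[of "{x. D x \<noteq> 0}"] by blast
  have fwd: "D ((F ^^ n) z) \<noteq> 0" if "D z \<noteq> 0" for z n
  proof (induction n)
    case (Suc n)
    then show ?case
      using conjugacy_chain_rule[OF D F G(1) conj, of "(F ^^ n) z"] G(2)[of "\<Phi> ((F ^^ n) z)"] by auto
  qed (use that in simp)
  obtain n where n: "(F ^^ n) (x + e) - (F ^^ n) x > 1"
    by (rule expanding_funpow_exceeds[OF exp, of x "x + e"]) (use e(1) in auto)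
  define k where "k = \<lceil>(F ^^ n) x - y\<rceil>"
  have k: "(F ^^ n) x \<le> y + of_int k" "y + of_int k \<le> (F ^^ n) (x + e)"
    using n ceiling_correct[of "(F ^^ n) x - y"] unfolding k_def[symmetric] by linarith+
  have "continuous_on UNIV F"
    using F by (auto simp: continuous_on_eq_continuous_at intro: DERIV_isCont)
  then have "continuous_on {x..x + e} (F ^^ n)"
    using continuous_on_funpow continuous_on_subset by blast
  then obtain z where z: "x \<le> z" "z \<le> x + e" "(F ^^ n) z = y + of_int k"
    using IVT'[where f = "F ^^ n", OF k] e(1) by auto
  have "z \<in> cball x e" using z by (simp add: dist_real_def)
  then have "D ((F ^^ n) z) \<noteq> 0" using fwd e(2) by blast
  moreover have "D (y + of_int k) = D y"
    using shift_of_int[of D 0 y k] deriv_periodic[OF D deg] by simp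
  ultimately show ?thesis using z(3) by simp
qed

section \<open>Reflection\<close>

lemma length_spectrum_reflect_subset:
  assumes f: "is_lift F f" and g: "is_lift G g"
    and G: "\<And>x. (G has_real_derivative G' x) (at x)"
    and refl: "\<And>x. F x = - G (- x)"
  shows "length_spectrum f \<subseteq> length_spectrum g"
proof -
  have refl_n: "(F ^^ n) x = - (G ^^ n) (- x)" for n x
    by (induction n) (simp_all add: refl)
  have diff_n: "\<exists>E. ((G ^^ n) has_real_derivative E) (at x)" for n x
  proof (induction n)
    case 0
    show ?case by (auto simp: id_def intro: DERIV_ident)
  next
    case (Suc n)
    then show ?case using DERIV_chain G by (metis funpow.simps(2))
  qed
  have "\<exists>q\<in>periodic_points g n. log_multiplier f n p = log_multiplier g n q"
    if p: "p \<in> periodic_points f n" for n p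
  proof -
    obtain x where x: "p = circ x" using circ_surj by blast
    note fn = is_lift_funpow[OF f, of n] and gn = is_lift_funpow[OF g, of n]
    have "(F ^^ n) x - x \<in> \<int>"
      using p fn unfolding x periodic_points_def is_lift_def circ_eq_iff[symmetric] by auto
    then have "(G ^^ n) (- x) - (- x) \<in> \<int>"
      unfolding refl_n using Ints_minus[of "- (G ^^ n) (- x) - x"] by (simp add: add.commute)
    then have q: "circ (- x) \<in> periodic_points g n"
      using gn unfolding periodic_points_def is_lift_def circ_eq_iff[symmetric] by auto
    obtain E where E: "((G ^^ n) has_real_derivative E) (at (- x))" using diff_n by blast
    have "((\<lambda>x. (G ^^ n) (- x)) has_real_derivative E * (- 1)) (at x)"
      by (rule DERIV_chain2[where g = uminus, OF E]) (auto intro!: derivative_eq_intros)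
    from DERIV_minus[OF this] have "((\<lambda>x. - (G ^^ n) (- x)) has_real_derivative E) (at x)"
      by simp
    then have "((F ^^ n) has_real_derivative E) (at x)"
      unfolding refl_n[symmetric] .
    then have "log_multiplier f n p = log_multiplier g n (circ (- x))"
      unfolding log_multiplier_def x using circle_deriv_eq fn gn E by metis
    then show ?thesis using q by blast
  qed
  then show ?thesis
    unfolding length_spectrum_def length_spectrum_of_period_def by fastforce
qed

section \<open>Trigonometric perturbations of the linear map\<close>

text \<open>
  The \<open>j\<close>-th derivative of \<open>m x + 2 a sin (2 \<pi> n x) sin (2 \<pi> x)\<close>. The perturbation is even,
  and it vanishes on the multiples of \<open>1 / n\<close>.
\<close>

definition trig :: "int \<Rightarrow> real \<Rightarrow> real \<Rightarrow> nat \<Rightarrow> real \<Rightarrow> real" where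
  "trig n m a j x =
     m * (if j = 0 then x else if j = 1 then 1 else 0) +
     a * ((2 * pi * of_int (n - 1)) ^ j * cos (2 * pi * of_int (n - 1) * x + real j * (pi / 2)) -
          (2 * pi * of_int (n + 1)) ^ j * cos (2 * pi * of_int (n + 1) * x + real j * (pi / 2)))"

lemma cos_add_half_pi: "cos (x + pi / 2) = - sin (x :: real)"
  by (simp add: cos_add)

lemma trig_has_derivative: "(trig n m a j has_real_derivative trig n m a (Suc j) x) (at x)"
proof -
  have cos': "cos (y + real (Suc j) * (pi / 2)) = - sin (y + real j * (pi / 2))" for y
    using cos_add_half_pi[of "y + real j * (pi / 2)"] by (simp add: algebra_simps add_divide_distrib)
  have "((\<lambda>x. m * (if j = 0 then x else if j = 1 then 1 else 0)) has_real_derivative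
      m * (if Suc j = 0 then x else if Suc j = 1 then 1 else 0)) (at x)"
    by (cases "j = 0") (auto intro!: derivative_eq_intros)
  then show ?thesis
    unfolding trig_def cos' by (rule DERIV_add) (auto intro!: derivative_eq_intros simp: algebra_simps)
qed

lemma deriv_funpow_trig: "(deriv ^^ j) (trig n m a 0) = trig n m a j"
proof (induction j)
  case (Suc j)
  then show ?case using DERIV_imp_deriv[OF trig_has_derivative] by auto
qed simp

lemma continuous_on_trig: "continuous_on UNIV (trig n m a j)"
  by (auto simp: continuous_on_eq_continuous_at intro: DERIV_isCont trig_has_derivative)

lemma trig_degree: "trig n m a 0 (x + 1) = trig n m a 0 x + m"
proof -
  have "cos (2 * pi * of_int k * (x + 1)) = cos (2 * pi * of_int k * x)" for k
    using sin_int_2pin[of k] cos_int_2pin[of k] by (simp add: distrib_left cos_add)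
  from this[of "n - 1"] this[of "n + 1"] show ?thesis
    unfolding trig_def by (simp add: distrib_left del: of_int_add of_int_diff)
qed

lemma trig_reflect: "trig n m (- a) 0 x = - trig n m a 0 (- x)"
  by (simp add: trig_def)

lemma trig_0: "trig n m a 0 0 = 0"
  by (simp add: trig_def)

lemma trig_split: "trig n m a j x = trig n m 0 j x + trig n 0 a j x"
  by (simp add: trig_def)

lemma trig_pert_bound:
  assumes "n \<ge> 1"
  shows "\<bar>trig n 0 a j x\<bar> \<le> 2 * \<bar>a\<bar> * (2 * pi * of_int (n + 1)) ^ j"
proof -
  let ?W = "2 * pi * of_int (n + 1) :: real"
  have b: "\<bar>w ^ j * cos y\<bar> \<le> ?W ^ j" if "0 \<le> w" "w \<le> ?W" for w y :: real
  proof -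
    have "\<bar>w ^ j * cos y\<bar> = w ^ j * \<bar>cos y\<bar>" using that(1) by (simp add: abs_mult)
    also have "\<dots> \<le> ?W ^ j * 1" by (intro mult_mono power_mono that) (use that in auto)
    finally show ?thesis by simp
  qed
  let ?u = "(2 * pi * of_int (n - 1)) ^ j * cos (2 * pi * of_int (n - 1) * x + real j * (pi / 2))"
  let ?v = "?W ^ j * cos (2 * pi * of_int (n + 1) * x + real j * (pi / 2))"
  have "\<bar>?u\<bar> \<le> ?W ^ j" "\<bar>?v\<bar> \<le> ?W ^ j"
    by (rule b; use assms in simp)+
  then have "\<bar>?u - ?v\<bar> \<le> 2 * ?W ^ j" by linarith
  then have "\<bar>a\<bar> * \<bar>?u - ?v\<bar> \<le> \<bar>a\<bar> * (2 * ?W ^ j)" by (rule mult_left_mono) simp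
  moreover have "trig n 0 a j x = a * (?u - ?v)" by (simp add: trig_def)
  ultimately show ?thesis by (simp add: abs_mult mult.assoc mult.left_commute)
qed

lemma trig_node:
  assumes "n \<noteq> 0"
  shows "trig n m a 0 (of_int k / of_int n) = m * (of_int k / of_int n)"
    and "trig n m a (Suc 0) (of_int k / of_int n) =
      m + 4 * pi * a * of_int n * sin (2 * pi * (of_int k / of_int n))"
proof -
  let ?y = "2 * pi * (of_int k / of_int n)"
  have "2 * pi * of_int (n - 1) * (of_int k / of_int n) = 2 * pi * of_int k - ?y"
    "2 * pi * of_int (n + 1) * (of_int k / of_int n) = 2 * pi * of_int k + ?y"
    using assms by (simp_all add: field_simps)
  note 1 = this
  have 2: "sin (2 * pi * of_int k) = 0" "cos (2 * pi * of_int k) = 1"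
    using sin_int_2pin[of k] cos_int_2pin[of k] by simp_all
  show "trig n m a 0 (of_int k / of_int n) = m * (of_int k / of_int n)"
    unfolding trig_def 1 by (simp add: cos_add cos_diff 2)
  show "trig n m a (Suc 0) (of_int k / of_int n) =
      m + 4 * pi * a * of_int n * sin ?y"
    unfolding trig_def 1 of_nat_1 mult_1 One_nat_def[symmetric] cos_add_half_pi sin_add sin_diff 2
    by (simp add: algebra_simps)
qed

lemma lipschitz_of_deriv_bound:
  fixes f :: "real \<Rightarrow> real"
  assumes "\<And>x. (f has_real_derivative f' x) (at x)" "\<And>x. \<bar>f' x\<bar> \<le> L"
  shows "L-lipschitz_on UNIV f"
proof (rule lipschitz_onI)
  show "dist (f x) (f y) \<le> L * dist x y" for x y
    using field_differentiable_bound[of UNIV f f' L x y] assms by (simp add: dist_norm)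
  show "0 \<le> L" using assms(2)[of 0] by linarith
qed

lemma Cr1_norm_trig_le:
  assumes "n \<ge> 1" "u \<circ> circ = trig n 0 a 0"
    and "2 * \<bar>a\<bar> * (2 * pi * of_int (n + 1)) ^ Suc r \<le> B"
  shows "Cr1_norm r u \<le> B"
proof -
  let ?W = "2 * pi * of_int (n + 1) :: real"
  have "1 * 1 \<le> (2 * pi) * of_int (n + 1)"
    using assms(1) pi_ge_two by (intro mult_mono) auto
  then have W: "1 \<le> ?W" by simp
  have bd: "\<bar>trig n 0 a j x\<bar> \<le> B" if "j \<le> Suc r" for j x
  proof -
    have "\<bar>trig n 0 a j x\<bar> \<le> 2 * \<bar>a\<bar> * ?W ^ j" by (rule trig_pert_bound[OF assms(1)])
    also have "\<dots> \<le> 2 * \<bar>a\<bar> * ?W ^ Suc r"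
      using W that by (intro mult_left_mono power_increasing) auto
    finally show ?thesis using assms(3) by linarith
  qed
  have "(SUP x. \<bar>(deriv ^^ j) (u \<circ> circ) x\<bar>) \<le> B" if "j \<le> r" for j
    unfolding assms(2) deriv_funpow_trig using that by (intro cSUP_least bd) auto
  moreover have "B-lipschitz_on UNIV ((deriv ^^ r) (u \<circ> circ))"
    unfolding assms(2) deriv_funpow_trig
    by (rule lipschitz_of_deriv_bound[OF trig_has_derivative bd]) simp
  then have "Inf {L. L-lipschitz_on UNIV ((deriv ^^ r) (u \<circ> circ))} \<le> B"
    by (intro cInf_lower) (auto intro!: bdd_belowI[of _ 0] simp: lipschitz_on_def)
  ultimately show ?thesis
    unfolding Cr1_norm_def by (subst Max_le_iff) auto
qed

lemma is_lift_trig: "is_lift (trig n (real d) a 0) (circle_map (trig n (real d) a 0))"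
  by (rule is_lift_circle_map[OF continuous_on_trig, of _ _ _ _ "int d"]) (simp add: trig_degree)

lemma trig_deriv_ge:
  assumes "d \<ge> 2" "n \<ge> 1" "2 * \<bar>a\<bar> * (2 * pi * of_int (n + 1)) \<le> 1 / 2"
  shows "trig n (real d) a (Suc 0) x \<ge> 3 / 2"
  using trig_pert_bound[OF assms(2), of a "Suc 0" x] assms(1,3)
  by (subst trig_split) (simp add: trig_def[of _ _ 0])

lemma trig_expanding:
  assumes "d \<ge> 2" "n \<ge> 1" "2 * \<bar>a\<bar> * (2 * pi * of_int (n + 1)) \<le> 1 / 2"
  shows "circle_map (trig n (real d) a 0) \<in> expanding_maps r d"
proof -
  let ?F = "trig n (real d) a 0"
  have "\<bar>trig n (real d) a (Suc r) x\<bar> \<le> real d + 2 * \<bar>a\<bar> * (2 * pi * of_int (n + 1)) ^ Suc r" for x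
  proof -
    have "\<bar>trig n (real d) 0 (Suc r) x\<bar> \<le> real d" by (simp add: trig_def)
    then show ?thesis
      using trig_pert_bound[OF assms(2), of a "Suc r" x] trig_split[of n "real d" a "Suc r" x]
      by linarith
  qed
  then have "Cr1_smooth r ?F"
    unfolding Cr1_smooth_def deriv_funpow_trig field_differentiable_def
    by (blast intro: trig_has_derivative lipschitz_of_deriv_bound)
  moreover have "circle_deriv (circle_map ?F) p > 1" for p
  proof -
    obtain x where "p = circ x" using circ_surj by blast
    then show ?thesis
      using circle_deriv_eq[OF is_lift_trig trig_has_derivative] trig_deriv_ge[OF assms, of x] by simp
  qed
  moreover have "circle_map ?F (circ 0) = circ 0"
    using is_lift_trig[of n d a] trig_0 unfolding is_lift_def by metis
  moreover have "has_degree (circle_map ?F) (int d)"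
    unfolding has_degree_def using is_lift_trig trig_degree by (metis of_int_of_nat_eq)
  ultimately show ?thesis
    unfolding expanding_maps_def circle_Cr1_smooth_def using is_lift_trig by blast
qed

lemma trig_stretch:
  assumes "d \<ge> 2" "n \<ge> 1" "2 * \<bar>a\<bar> * (2 * pi * of_int (n + 1)) \<le> 1 / 2" "x \<le> y"
  shows "3 / 2 * (y - x) \<le> trig n (real d) a 0 y - trig n (real d) a 0 x"
proof (cases "x < y")
  case True
  then obtain z where "trig n (real d) a 0 y - trig n (real d) a 0 x = (y - x) * trig n (real d) a (Suc 0) z"
    using MVT2[OF True trig_has_derivative] by blast
  then show ?thesis
    using mult_left_mono[OF trig_deriv_ge[OF assms(1-3), of z], of "y - x"] True by simp
qed (use assms in simp)

lemma trig_linearization: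
  assumes "d \<ge> 2" "n \<ge> 1" "2 * \<bar>a\<bar> * (2 * pi * of_int (n + 1)) \<le> 1 / 2"
  obtains H K where
    "continuous_on UNIV H" "strict_mono H" "H 0 = 0" "\<And>x. H (x + 1) = H x + 1"
    "\<And>x. H (trig n (real d) a 0 x) = real d * H x"
    "continuous_on UNIV K" "strict_mono K" "\<And>x. K (x + 1) = K x + 1"
    "\<And>x. K (H x) = x" "\<And>x. H (K x) = x"
proof -
  have "\<bar>trig n (real d) a 0 x - real d * x\<bar> \<le> 2 * \<bar>a\<bar>" for x
    using trig_pert_bound[OF assms(2), of a 0 x] by (subst trig_split) (simp add: trig_def[of _ _ 0])
  from expanding_linearization[OF continuous_on_trig trig_degree _ trig_0 this trig_stretch[OF assms]]
  obtain H where H: "continuous_on UNIV H" "strict_mono H" "H 0 = 0" "\<And>x. H (x + 1) = H x + 1"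
    "\<And>x. H (trig n (real d) a 0 x) = real d * H x"
    using assms(1) by auto
  show thesis
    by (rule degree_one_inverse[OF H(1,2,4)]) (auto intro: that H)
qed

section \<open>The distinguished orbit of period 3\<close>

lemma linearization_orbit:
  fixes H :: "real \<Rightarrow> real"
  assumes "d \<ge> 2" "n = int d ^ 3 - 1"
    and H: "\<And>x. H (x + 1) = H x + 1" "\<And>x. H (trig n (real d) a 0 x) = real d * H x"
    and "i \<le> 2"
  shows "H (of_int (int d ^ i) / of_int n) = of_int (int d ^ i) / of_int n"
proof -
  have "(2::int) ^ 3 \<le> int d ^ 3" using assms(1) by (intro power_mono) auto
  then have "n > 0" using assms(2) by simp
  then have n: "n \<noteq> 0" "(of_int n :: real) > 0" by auto
  have step: "H (of_int (int d ^ Suc j) / of_int n) = real d * H (of_int (int d ^ j) / of_int n)" for j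
    using H(2)[of "of_int (int d ^ j) / of_int n"] trig_node(1)[OF n(1), of "real d" a "int d ^ j"]
    by simp
  then have pow: "H (of_int (int d ^ j) / of_int n) = real d ^ j * H (1 / of_int n)" for j
    by (induction j) simp_all
  have d3: "int d ^ 3 = n + 1" using assms(2) by simp
  have "of_int (int d ^ 3) / of_int n = 1 / of_int n + (1 :: real)"
    using n by (simp add: d3 add_divide_distrib add.commute)
  then have "H (1 / of_int n) + 1 = real d ^ 3 * H (1 / of_int n)"
    using pow[of 3] H(1) by metis
  moreover have "real d ^ 3 = of_int n + 1" using assms(2) by simp
  ultimately have "H (1 / of_int n) = 1 / of_int n"
    using n by (simp add: field_simps)
  then show ?thesis using pow[of i] by simp
qed

lemma orbit_sines:
  assumes "d \<ge> 2" "n = int d ^ 3 - 1"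
  shows "sin (2 * pi * (of_int (int d ^ 1) / of_int n)) > 0"
    and "sin (2 * pi * (of_int (int d ^ 0) / of_int n)) + sin (2 * pi * (of_int (int d ^ 2) / of_int n)) > 0"
proof -
  define e where "e = real d"
  have e: "e \<ge> 2" using assms(1) by (simp add: e_def)
  have n: "of_int n = e ^ 3 - 1" using assms(2) by (simp add: e_def)
  have e3: "2 * e ^ 2 \<le> e ^ 3" "4 * e \<le> e ^ 3"
    using mult_mono[OF e e] mult_right_mono[OF e, of "e ^ 2"] mult_right_mono[of 4 "e * e" e] e
    by (simp_all add: power2_eq_square power3_eq_cube mult.assoc)
  have pos: "e ^ 3 - 1 > 0" using e3 e by linarith
  show "sin (2 * pi * (of_int (int d ^ 1) / of_int n)) > 0"
  proof (rule sin_gt_zero)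
    show "0 < 2 * pi * (of_int (int d ^ 1) / of_int n)" using pos e by (simp add: n e_def[symmetric])
    have "2 * (e / (e ^ 3 - 1)) < 1" using pos e e3 by (simp add: field_simps)
    then have "pi * (2 * (e / (e ^ 3 - 1))) < pi * 1" by (intro mult_strict_left_mono) auto
    then show "2 * pi * (of_int (int d ^ 1) / of_int n) < pi" by (simp add: n e_def[symmetric] mult_ac)
  qed
  define A where "A = 2 * pi * (of_int (int d ^ 0) / of_int n)"
  define B where "B = 2 * pi * (of_int (int d ^ 2) / of_int n)"
  have sum: "(A + B) / 2 = pi * ((1 + e ^ 2) / (e ^ 3 - 1))"
    and dif: "(A - B) / 2 = - (pi * ((e ^ 2 - 1) / (e ^ 3 - 1)))"
    unfolding A_def B_def using pos by (simp_all add: n e_def[symmetric] divide_simps) (simp_all add: algebra_simps)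
  have "e ^ 2 \<ge> 4" using mult_mono[OF e e] e by (simp add: power2_eq_square)
  then have q: "0 < (1 + e ^ 2) / (e ^ 3 - 1)" "(1 + e ^ 2) / (e ^ 3 - 1) < 1"
    "0 < (e ^ 2 - 1) / (e ^ 3 - 1)" "(e ^ 2 - 1) / (e ^ 3 - 1) < 1 / 2"
    using pos e3 by (simp_all add: field_simps)
  have "pi * ((1 + e ^ 2) / (e ^ 3 - 1)) < pi * 1" "pi * ((e ^ 2 - 1) / (e ^ 3 - 1)) < pi * (1 / 2)"
    using q by (auto intro: mult_strict_left_mono simp del: times_divide_eq_right)
  moreover have "0 < pi * ((1 + e ^ 2) / (e ^ 3 - 1))" "0 < pi * ((e ^ 2 - 1) / (e ^ 3 - 1))"
    using q by (intro mult_pos_pos; simp)+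
  ultimately have "sin ((A + B) / 2) > 0" "cos ((A - B) / 2) > 0"
    unfolding sum dif cos_minus by (intro sin_gt_zero cos_gt_zero_pi; linarith)+
  then have "sin A + sin B > 0" by (simp add: sin_plus_sin)
  then show "sin (2 * pi * (of_int (int d ^ 0) / of_int n)) + sin (2 * pi * (of_int (int d ^ 2) / of_int n)) > 0"
    by (simp add: A_def B_def)
qed

lemma orbit_multipliers_differ:
  fixes e c s0 s1 s2 :: real
  assumes "e > 0" "c > 0" "s1 > 0" "s0 + s2 > 0"
    and "e - c * s0 > 0" "e - c * s1 > 0" "e - c * s2 > 0"
  shows "(e - c * s0) * (e - c * s1) * (e - c * s2) < (e + c * s0) * (e + c * s1) * (e + c * s2)"
proof -
  have "(e + c * s0) * (e + c * s2) - (e - c * s0) * (e - c * s2) = 2 * e * c * (s0 + s2)"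
    by (simp add: algebra_simps)
  moreover have "\<dots> > 0" using assms by simp
  ultimately have 1: "(e - c * s0) * (e - c * s2) < (e + c * s0) * (e + c * s2)" by linarith
  have 2: "(e - c * s0) * (e - c * s2) > 0" using assms by simp
  have "c * s1 > 0" using assms by simp
  then have "((e - c * s0) * (e - c * s2)) * (e - c * s1) < ((e + c * s0) * (e + c * s2)) * (e + c * s1)"
    using assms(6) 1 2 by (intro mult_strict_mono[OF 1]; linarith)
  then show ?thesis by (simp add: mult_ac)
qed

lemma trig_conjugacy_not_C1:
  fixes D :: "real \<Rightarrow> real"
  assumes "d \<ge> 2" "n = int d ^ 3 - 1" "a > 0"
    and small: "2 * \<bar>a\<bar> * (2 * pi * of_int (n + 1)) \<le> 1 / 2"
    and D: "\<And>x. (\<Phi> has_real_derivative D x) (at x)" "continuous_on UNIV D"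
    and deg: "\<And>x. \<Phi> (x + 1) = \<Phi> x + 1"
    and conj: "\<And>x. \<Phi> (trig n (real d) (- a) 0 x) = trig n (real d) a 0 (\<Phi> x)"
    and orbit: "\<And>i. i \<le> 2 \<Longrightarrow> \<Phi> (of_int (int d ^ i) / of_int n) = of_int (int d ^ i) / of_int n"
  shows False
proof -
  have "(2::int) ^ 3 \<le> int d ^ 3" using assms(1) by (intro power_mono) auto
  then have n: "n \<ge> 1" using assms(2) by simp
  then have n0: "n \<noteq> 0" "(of_int n :: real) > 0" by auto
  have small': "2 * \<bar>- a\<bar> * (2 * pi * of_int (n + 1)) \<le> 1 / 2" using small by simp
  define p where "p i = (of_int (int d ^ i) / of_int n :: real)" for i
  define s where "s i = sin (2 * pi * p i)" for i
  define c where "c = 4 * pi * a * of_int n"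
  have F': "trig n (real d) (- a) (Suc 0) (p i) = real d - c * s i"
    and G': "trig n (real d) a (Suc 0) (p i) = real d + c * s i" for i
    unfolding p_def s_def c_def trig_node(2)[OF n0(1)] by simp_all
  have G'nz: "trig n (real d) a (Suc 0) x \<noteq> 0" for x
    using trig_deriv_ge[OF assms(1) n small, of x] by linarith
  have nz: "D x \<noteq> 0" for x
    by (rule C1_conjugacy_deriv_nonzero[OF D deg trig_has_derivative trig_has_derivative G'nz conj
          trig_stretch[OF assms(1) n small']]) simp_all
  have step: "D (p (Suc i)) * (real d - c * s i) = (real d + c * s i) * D (p i)" if "i \<le> 2" for i
  proof -
    have "trig n (real d) (- a) 0 (p i) = p (Suc i)"
      unfolding p_def trig_node(1)[OF n0(1)] by simp
    moreover have "\<Phi> (p i) = p i" unfolding p_def by (rule orbit[OF that])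
    ultimately show ?thesis
      using conjugacy_chain_rule[OF D(1) trig_has_derivative trig_has_derivative conj, of "p i"]
      by (simp add: F' G')
  qed
  have d3: "int d ^ 3 = n + 1" using assms(2) by simp
  have "p 3 = p 0 + 1" using n0 by (simp add: p_def d3 add_divide_distrib)
  then have "D (p 3) = D (p 0)" using deriv_periodic[OF D(1) deg] by simp
  then have steps: "D (p 1) * (real d - c * s 0) = (real d + c * s 0) * D (p 0)"
    "D (p 2) * (real d - c * s 1) = (real d + c * s 1) * D (p 1)"
    "D (p 0) * (real d - c * s 2) = (real d + c * s 2) * D (p 2)"
    using step[of 0] step[of 1] step[of 2] by (simp_all add: eval_nat_numeral)
  have "D (p 0) * D (p 1) * D (p 2) * ((real d - c * s 0) * (real d - c * s 1) * (real d - c * s 2))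
      = D (p 0) * D (p 1) * D (p 2) * ((real d + c * s 0) * (real d + c * s 1) * (real d + c * s 2))"
    (is "?l = ?r")
  proof -
    have "?l = (D (p 1) * (real d - c * s 0)) * (D (p 2) * (real d - c * s 1)) * (D (p 0) * (real d - c * s 2))"
      by (simp only: mult_ac)
    also have "\<dots> = ?r" unfolding steps by (simp only: mult_ac)
    finally show ?thesis .
  qed
  then have "(real d - c * s 0) * (real d - c * s 1) * (real d - c * s 2)
      = (real d + c * s 0) * (real d + c * s 1) * (real d + c * s 2)"
    using nz by simp
  moreover have "real d - c * s i > 0" for i
    using trig_deriv_ge[OF assms(1) n small', of "p i"] F' by simp
  moreover have "c > 0" using assms(3) n0 by (simp add: c_def)
  moreover have "s 1 > 0" "s 0 + s 2 > 0"
    unfolding s_def p_def by (fact orbit_sines[OF assms(1,2)])+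
  moreover have "real d > 0" using assms(1) by simp
  ultimately show False
    using orbit_multipliers_differ[of "real d" c "s 1" "s 0" "s 2"] by (metis less_irrefl)
qed

lemma trig_maps_conjugate_not_C1:
  assumes "d \<ge> 2" "n = int d ^ 3 - 1" "a > 0"
    and small: "2 * \<bar>a\<bar> * (2 * pi * of_int (n + 1)) \<le> 1 / 2"
  shows "\<exists>\<phi>. marking_conjugacy (circle_map (trig n (real d) (- a) 0))
      (circle_map (trig n (real d) a 0)) \<phi> \<and> \<not> circle_C1 \<phi>"
proof -
  have "(2::int) ^ 3 \<le> int d ^ 3" using assms(1) by (intro power_mono) auto
  then have n: "n \<ge> 1" using assms(2) by simp
  have small': "2 * \<bar>- a\<bar> * (2 * pi * of_int (n + 1)) \<le> 1 / 2" using small by simp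
  obtain H1 K1 where f:
    "continuous_on UNIV H1" "strict_mono H1" "H1 0 = 0" "\<And>x. H1 (x + 1) = H1 x + 1"
    "\<And>x. H1 (trig n (real d) (- a) 0 x) = real d * H1 x"
    "continuous_on UNIV K1" "strict_mono K1" "\<And>x. K1 (x + 1) = K1 x + 1"
    "\<And>x. K1 (H1 x) = x" "\<And>x. H1 (K1 x) = x"
    by (rule trig_linearization[OF assms(1) n small']) (rule that)
  obtain H2 K2 where g:
    "continuous_on UNIV H2" "strict_mono H2" "H2 0 = 0" "\<And>x. H2 (x + 1) = H2 x + 1"
    "\<And>x. H2 (trig n (real d) a 0 x) = real d * H2 x"
    "continuous_on UNIV K2" "strict_mono K2" "\<And>x. K2 (x + 1) = K2 x + 1"
    "\<And>x. K2 (H2 x) = x" "\<And>x. H2 (K2 x) = x"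
    by (rule trig_linearization[OF assms(1) n small]) (rule that)
  define \<Phi> where "\<Phi> x = K2 (H1 x)" for x
  define \<Psi> where "\<Psi> x = K1 (H2 x)" for x
  have deg: "\<Phi> (x + 1) = \<Phi> x + 1" "\<Psi> (x + 1) = \<Psi> x + 1" for x
    by (simp_all add: \<Phi>_def \<Psi>_def f g)
  have cont: "continuous_on UNIV \<Phi>" "continuous_on UNIV \<Psi>"
    unfolding \<Phi>_def \<Psi>_def
    by (auto intro: continuous_on_compose2[OF f(6) g(1)] continuous_on_compose2[OF g(6) f(1)])
  have lift: "is_lift \<Phi> (circle_map \<Phi>)" "is_lift \<Psi> (circle_map \<Psi>)"
    using is_lift_circle_map[OF cont(1), of 1] is_lift_circle_map[OF cont(2), of 1] deg by simp_all
  have conj: "\<Phi> (trig n (real d) (- a) 0 x) = trig n (real d) a 0 (\<Phi> x)" for x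
  proof -
    have "trig n (real d) a 0 (\<Phi> x) = K2 (H2 (trig n (real d) a 0 (\<Phi> x)))"
      by (simp only: g(9))
    also have "\<dots> = K2 (real d * H1 x)" by (simp only: g(5,10) \<Phi>_def)
    finally show ?thesis by (simp only: f(5) \<Phi>_def)
  qed
  have "marking_conjugacy (circle_map (trig n (real d) (- a) 0)) (circle_map (trig n (real d) a 0)) (circle_map \<Phi>)"
  proof (rule marking_conjugacy_of_lifts[OF is_lift_trig is_lift_trig lift _ _ _ _ conj])
    show "strict_mono \<Phi>" unfolding \<Phi>_def
      by (rule strict_monoI) (simp add: strict_mono_less[OF g(7)] strict_mono_less[OF f(2)])
    show "\<Phi> 0 = 0" unfolding \<Phi>_def using g(9)[of 0] by (simp add: f(3) g(3))
  qed (simp_all add: \<Phi>_def \<Psi>_def f g)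
  moreover have "\<not> circle_C1 (circle_map \<Phi>)"
  proof
    assume "circle_C1 (circle_map \<Phi>)"
    then obtain T D where T: "is_lift T (circle_map \<Phi>)"
      "\<And>x. (T has_vector_derivative D x) (at x)" "continuous_on UNIV D"
      unfolding circle_C1_def C1_differentiable_on_def by auto
    obtain k :: int where "\<forall>x. \<Phi> x = T x + of_int k"
      using is_lift_unique[OF lift(1) T(1)] by blast
    then have \<Phi>: "\<Phi> = (\<lambda>x. T x + of_int k)" by auto
    have D: "(\<Phi> has_real_derivative D x) (at x)" for x
    proof -
      have "(T has_real_derivative D x) (at x)"
        using T(2)[of x] by (simp add: has_real_derivative_iff_has_vector_derivative)
      from DERIV_add[OF this DERIV_const[of "of_int k"]] show ?thesis unfolding \<Phi> by simp
    qed
    have "\<Phi> (of_int (int d ^ i) / of_int n) = of_int (int d ^ i) / of_int n" if "i \<le> 2" for i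
    proof -
      have "H1 (of_int (int d ^ i) / of_int n) = H2 (of_int (int d ^ i) / of_int n)"
        unfolding linearization_orbit[OF assms(1,2) f(4,5) that]
          linearization_orbit[OF assms(1,2) g(4,5) that] ..
      then show ?thesis by (simp only: \<Phi>_def g(9))
    qed
    then show False
      using trig_conjugacy_not_C1[OF assms D T(3) deg(1) conj] by blast
  qed
  ultimately show ?thesis by blast
qed

lemma lift_diff_trig:
  assumes "circle_map (trig n (real d) a 0) \<in> expanding_maps r d"
    and "circle_map (trig n (real d) b 0) \<in> expanding_maps r d"
  shows "lift_diff (circle_map (trig n (real d) a 0)) (circle_map (trig n (real d) b 0)) \<circ> circ =
    trig n 0 (a - b) 0"
proof
  fix x
  show "(lift_diff (circle_map (trig n (real d) a 0)) (circle_map (trig n (real d) b 0)) \<circ> circ) x =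
      trig n 0 (a - b) 0 x"
    unfolding o_apply lift_diff_circ[OF assms] lift0_eq[OF is_lift_trig trig_0]
    by (simp add: trig_def left_diff_distrib)
qed

lemma linear_circle_map_eq_trig: "linear_circle_map d = circle_map (trig n (real d) 0 0)"
proof -
  have "trig n (real d) 0 0 = (\<lambda>x. real d * x)" by (simp add: trig_def fun_eq_iff)
  then show ?thesis using is_lift_map_unique[OF is_lift_linear] is_lift_trig by metis
qed

lemma trig_nonlinear:
  assumes "d \<ge> 2" "n = int d ^ 3 - 1" "a > 0"
  shows "circle_map (trig n (real d) a 0) \<noteq> linear_circle_map d"
proof
  assume eq: "circle_map (trig n (real d) a 0) = linear_circle_map d"
  have "(2::int) ^ 3 \<le> int d ^ 3" using assms(1) by (intro power_mono) auto
  then have "n > 0" using assms(2) by simp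
  then have n: "n \<noteq> 0" "(of_int n :: real) > 0" by auto
  let ?x = "of_int (int d ^ 1) / of_int n :: real"
  have "circle_deriv (linear_circle_map d) (circ ?x) = trig n (real d) a (Suc 0) ?x"
    using circle_deriv_eq[OF is_lift_trig trig_has_derivative] eq by metis
  moreover have "circle_deriv (linear_circle_map d) (circ ?x) = trig n (real d) 0 (Suc 0) ?x"
    unfolding linear_circle_map_eq_trig[of d n]
    by (rule circle_deriv_eq[OF is_lift_trig trig_has_derivative])
  ultimately have "4 * pi * a * of_int n * sin (2 * pi * ?x) = 0"
    unfolding trig_node(2)[OF n(1)] by linarith
  moreover have "0 < 4 * pi * a * of_int n * sin (2 * pi * ?x)"
    using orbit_sines(1)[OF assms(1,2)] assms(3) n by (intro mult_pos_pos) auto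
  ultimately show False by linarith
qed

theorem mainTheorem1:
  fixes d r :: nat and \<epsilon> \<delta> :: real
  assumes "d \<ge> 2" and "r \<ge> 2" and "\<epsilon> > 0" and "\<delta> > 0"
  shows "\<exists>g \<in> expanding_maps r d.
           g \<noteq> linear_circle_map d \<and>
           Cr1_norm r (lift_diff g (linear_circle_map d)) \<le> \<delta> \<and>
           (\<exists>f \<in> expanding_maps r d.
              Cr1_norm r (lift_diff f g) \<le> \<epsilon> \<and>
              length_spectrum f = length_spectrum g \<and>
              (\<exists>\<phi>. marking_conjugacy f g \<phi> \<and> \<not> circle_C1 \<phi>))"
proof -
  define n where "n = int d ^ 3 - 1"
  have "(2::int) ^ 3 \<le> int d ^ 3" using assms(1) by (intro power_mono) auto
  then have n: "n \<ge> 1" by (simp add: n_def)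
  define W where "W = 2 * pi * of_int (n + 1)"
  have "1 * 1 \<le> (2 * pi) * of_int (n + 1)"
    using n pi_ge_two by (intro mult_mono) auto
  then have W: "1 \<le> W" by (simp add: W_def)
  define m where "m = min (min \<epsilon> \<delta>) (1 / 2)"
  have m: "m > 0" "m \<le> \<epsilon>" "m \<le> \<delta>" "m \<le> 1 / 2" using assms by (auto simp: m_def)
  define a where "a = m / (4 * W ^ Suc r)"
  have Wr: "W ^ Suc r > 0" using W by simp
  have a: "a > 0" using m Wr by (simp add: a_def)
  have am: "4 * a * W ^ Suc r = m" using W by (simp add: a_def)
  have aW: "0 < a * W ^ Suc r" using a Wr by simp
  have "a * W \<le> a * W ^ Suc r"
    using a W power_increasing[of 1 "Suc r" W] by (intro mult_left_mono) auto
  then have small: "2 * \<bar>b\<bar> * (2 * pi * of_int (n + 1)) \<le> 1 / 2" if "\<bar>b\<bar> \<le> a" for b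
    using am m aW a mult_right_mono[OF that, of W] W unfolding W_def[symmetric] by linarith
  let ?f = "circle_map (trig n (real d) (- a) 0)" and ?g = "circle_map (trig n (real d) a 0)"
  have f: "?f \<in> expanding_maps r d" and g: "?g \<in> expanding_maps r d"
    and L: "circle_map (trig n (real d) 0 0) \<in> expanding_maps r d"
    using a by (auto intro!: trig_expanding[OF assms(1) n] small)
  have "Cr1_norm r (lift_diff ?g (linear_circle_map d)) \<le> \<delta>"
    unfolding linear_circle_map_eq_trig[of d n]
    by (rule Cr1_norm_trig_le[OF n lift_diff_trig[OF g L]])
      (use am m a aW in \<open>simp add: W_def[symmetric] del: power_Suc of_int_add\<close>)
  moreover have "Cr1_norm r (lift_diff ?f ?g) \<le> \<epsilon>"
    by (rule Cr1_norm_trig_le[OF n lift_diff_trig[OF f g]])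
      (use am m a in \<open>simp add: W_def[symmetric] del: power_Suc of_int_add\<close>)
  moreover have "length_spectrum ?f = length_spectrum ?g"
    using length_spectrum_reflect_subset[OF is_lift_trig is_lift_trig trig_has_derivative, of n d "- a" n d a]
      length_spectrum_reflect_subset[OF is_lift_trig is_lift_trig trig_has_derivative, of n d a n d "- a"]
      trig_reflect[of n "real d" a] trig_reflect[of n "real d" "- a"]
    by auto
  moreover have "\<exists>\<phi>. marking_conjugacy ?f ?g \<phi> \<and> \<not> circle_C1 \<phi>"
    using trig_maps_conjugate_not_C1[OF assms(1) n_def a small] a by simp
  moreover have "?g \<noteq> linear_circle_map d"
    by (rule trig_nonlinear[OF assms(1) n_def a])
  ultimately show ?thesis using f g by blast
qed

end
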